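(* Let $X\in\mathbb R^{p_1\times\cdots\times p_d}$ be a tensor and for each $j\in\{1,\dots,d\}$ let $U_j\in\mathbb R^{p_j\times r_j}$ have orthonormal columns, with orthogonal complement $U_{j\,\perp}\in\mathbb R^{p_j\times(p_j-r_j)}$. For each $k\in\{1,\dots,d\}$, let $W_{-k}=\otimes_{j\ne k}U_j$ and let $W_{-k\,\perp}$ be a matrix whose columns form an orthonormal basis of $\mathrm{span}(W_{-k})^\perp$. Then, for each $k$, $$\big\|\mathcal M_k(X)\cdot W_{-k\,\perp}\big\|_{\mathrm F}\le\sum_{j\ne k}\big\|X\times_jU_{j\,\perp}\big\|_{\mathrm F}.$$
   Context: $\mathcal M_k(X)$ is the mode-$k$ matricization (the $p_k\times\prod_{j\ne k}p_j$ unfolding) of $X$, with column ordering compatible with the Kronecker product $\otimes_{j\ne k}$. $X\times_jU_{j\,\perp}$ denotes the contraction of the $j$th mode of $X$ with the columns of $U_{j\,\perp}$, i.e. its mode-$j$ index $i\in\{1,\dots,p_j-r_j\}$ entry is $\sum_{\mu_j=1}^{p_j}X_{\mu_1,\dots,\mu_d}(U_{j\,\perp})_{\mu_j,i}$. $\|\cdot\|_{\mathrm F}$ is the Frobenius norm (square root of the sum of squared entries) of a matrix or tensor; $\mathrm{span}(W)$ is the column space of $W$. $U_{j\,\perp}$ is such that $[U_j\ U_{j\,\perp}]$ is an orthogonal matrix. *)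

theory Defs
  imports "Jordan_Normal_Form.VS_Connect" "HOL-Library.FuncSet"
begin

text \<open>
  A tensor of order \<open>d\<close> and size \<open>p 1, \<dots>, p d\<close> is a function on multi-indices: extensional
  functions \<open>\<mu>\<close> on the modes \<open>1, \<dots>, d\<close> with \<open>\<mu> j < p j\<close>.  Modes are numbered from 1; entries within
  a mode are numbered from 0, as in the matrix library.  The values of the function outside
  \<open>multi_indices d p\<close> are never inspected.
\<close>

type_synonym tensor = "(nat \<Rightarrow> nat) \<Rightarrow> real"

definition multi_indices :: "nat \<Rightarrow> (nat \<Rightarrow> nat) \<Rightarrow> (nat \<Rightarrow> nat) set" where
  "multi_indices d p = (\<Pi>\<^sub>E j\<in>{1..d}. {..<p j})"

definition tensor_frob :: "nat \<Rightarrow> (nat \<Rightarrow> nat) \<Rightarrow> tensor \<Rightarrow> real" where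
  "tensor_frob d p X = sqrt (\<Sum>\<mu>\<in>multi_indices d p. (X \<mu>)\<^sup>2)"

definition mat_frob :: "real mat \<Rightarrow> real" where
  "mat_frob A = sqrt (\<Sum>i<dim_row A. \<Sum>j<dim_col A. (A $$ (i, j))\<^sup>2)"

text \<open>
  If \<open>X\<close> has size \<open>p\<close> and \<open>A\<close> is a \<open>p j \<times> q\<close> matrix, then \<open>mode_contract j X A\<close> has size \<open>p(j := q)\<close>.
\<close>

definition mode_contract :: "nat \<Rightarrow> tensor \<Rightarrow> real mat \<Rightarrow> tensor" where
  "mode_contract j X A = (\<lambda>\<nu>. \<Sum>m<dim_row A. X (\<nu>(j := m)) * A $$ (m, \<nu> j))"

definition kron :: "real mat \<Rightarrow> real mat \<Rightarrow> real mat" where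
  "kron A B = mat (dim_row A * dim_row B) (dim_col A * dim_col B)
     (\<lambda>(i, j). A $$ (i div dim_row B, j div dim_col B) * B $$ (i mod dim_row B, j mod dim_col B))"

text \<open>The empty Kronecker product is the \<open>1 \<times> 1\<close> identity matrix.\<close>

definition kron_list :: "real mat list \<Rightarrow> real mat" where
  "kron_list As = foldr kron As (1\<^sub>m 1)"

definition other_modes :: "nat \<Rightarrow> nat \<Rightarrow> nat list" where
  "other_modes d k = filter (\<lambda>j. j \<noteq> k) [1..<Suc d]"

text \<open>
  \<open>unrank p js c\<close> is the multi-index (on the modes in \<open>js\<close>) at position \<open>c\<close> of the lexicographic order,
  the first mode of \<open>js\<close> being the most significant.  This is the order in which the rows of a Kronecker
  product are enumerated, see \<open>kron_list_index\<close> below.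
\<close>

fun unrank :: "(nat \<Rightarrow> nat) \<Rightarrow> nat list \<Rightarrow> nat \<Rightarrow> nat \<Rightarrow> nat" where
  "unrank p [] c = (\<lambda>_. undefined)"
| "unrank p (j # js) c =
     (unrank p js (c mod (\<Prod>l\<leftarrow>js. p l)))(j := c div (\<Prod>l\<leftarrow>js. p l))"

definition matricize :: "nat \<Rightarrow> (nat \<Rightarrow> nat) \<Rightarrow> nat \<Rightarrow> tensor \<Rightarrow> real mat" where
  "matricize d p k X = mat (p k) (\<Prod>j\<in>{1..d} - {k}. p j)
     (\<lambda>(i, c). X ((unrank p (other_modes d k) c)(k := i)))"

definition orthonormal_cols :: "real mat \<Rightarrow> bool" where
  "orthonormal_cols A \<longleftrightarrow>
     (\<forall>i<dim_col A. \<forall>j<dim_col A. col A i \<bullet> col A j = (if i = j then 1 else 0))"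

text \<open>
  The library's \<open>orthogonal_mat\<close> only requires nonzero, pairwise orthogonal columns, so it cannot be
  used here.
\<close>

definition real_orthogonal_mat :: "real mat \<Rightarrow> bool" where
  "real_orthogonal_mat Q \<longleftrightarrow> square_mat Q \<and> Q\<^sup>T * Q = 1\<^sub>m (dim_row Q)"

definition hconcat :: "real mat \<Rightarrow> real mat \<Rightarrow> real mat" where
  "hconcat A B = mat_of_cols (dim_row A) (cols A @ cols B)"

definition orthonormal_basis_of_complement :: "real mat \<Rightarrow> real mat \<Rightarrow> bool" where
  "orthonormal_basis_of_complement W V \<longleftrightarrow>
     dim_row V = dim_row W \<and> orthonormal_cols V \<and>
     vec_space.col_space (dim_row W) V =
       vec_module.orthogonal_complement (dim_row W) (vec_space.col_space (dim_row W) W)"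

lemma prod_list_other_modes:
  "(\<Prod>j\<leftarrow>other_modes d k. p j) = (\<Prod>j\<in>{1..d} - {k}. p j :: nat)"
proof -
  have "distinct (other_modes d k)" and "set (other_modes d k) = {1..d} - {k}"
    unfolding other_modes_def by auto
  then show ?thesis by (metis prod.distinct_set_conv_list)
qed

lemma dim_kron_list [simp]:
  "dim_row (kron_list (map U js)) = (\<Prod>j\<leftarrow>js. dim_row (U j))"
  "dim_col (kron_list (map U js)) = (\<Prod>j\<leftarrow>js. dim_col (U j))"
  by (induction js) (auto simp: kron_list_def kron_def)

lemma kron_list_index:
  assumes "distinct js"
    and "a < (\<Prod>j\<leftarrow>js. dim_row (U j))" and "b < (\<Prod>j\<leftarrow>js. dim_col (U j))"
  shows "kron_list (map U js) $$ (a, b) =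
    (\<Prod>j\<in>set js. U j $$ (unrank (\<lambda>l. dim_row (U l)) js a j, unrank (\<lambda>l. dim_col (U l)) js b j))"
  using assms
proof (induction js arbitrary: a b)
  case Nil
  then show ?case by (simp add: kron_list_def)
next
  case (Cons x js)
  let ?R = "\<Prod>j\<leftarrow>js. dim_row (U j)" and ?C = "\<Prod>j\<leftarrow>js. dim_col (U j)"
  have pos: "?R > 0" "?C > 0" using Cons.prems by (auto intro!: Nat.gr0I)
  have IH: "kron_list (map U js) $$ (a mod ?R, b mod ?C) =
    (\<Prod>j\<in>set js. U j $$ (unrank (\<lambda>l. dim_row (U l)) js (a mod ?R) j,
                         unrank (\<lambda>l. dim_col (U l)) js (b mod ?C) j))"
    using Cons.prems pos by (intro Cons.IH) auto
  have "kron_list (map U (x # js)) = kron (U x) (kron_list (map U js))"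
    by (simp add: kron_list_def)
  then have "kron_list (map U (x # js)) $$ (a, b) =
      U x $$ (a div ?R, b div ?C) * kron_list (map U js) $$ (a mod ?R, b mod ?C)"
    using Cons.prems by (simp add: kron_def)
  also have "\<dots> = U x $$ (a div ?R, b div ?C) *
    (\<Prod>j\<in>set js. U j $$ (unrank (\<lambda>l. dim_row (U l)) (x # js) a j,
                         unrank (\<lambda>l. dim_col (U l)) (x # js) b j))"
    unfolding IH using Cons.prems(1)
    by (intro arg_cong2[where f = "(*)"] prod.cong refl) auto
  finally show ?case using Cons.prems(1) by simp
qed

lemma bij_betw_unrank:
  assumes "distinct js"
  shows "bij_betw (unrank p js) {..<(\<Prod>j\<leftarrow>js. p j)} (\<Pi>\<^sub>E j\<in>set js. {..<p j})"
  using assms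
proof (induction js)
  case Nil
  then show ?case by (auto simp: bij_betw_def lessThan_Suc)
next
  case (Cons x js)
  let ?N = "\<Prod>j\<leftarrow>js. p j"
  have bij: "bij_betw (unrank p js) {..<?N} (\<Pi>\<^sub>E j\<in>set js. {..<p j})"
    using Cons by simp
  have x: "x \<notin> set js" using Cons.prems by simp
  have mem: "unrank p js b \<in> (\<Pi>\<^sub>E j\<in>set js. {..<p j})" if "b < ?N" for b
    using bij_betwE[OF bij] that by blast
  show ?case
    unfolding bij_betw_def
  proof
    show "inj_on (unrank p (x # js)) {..<\<Prod>j\<leftarrow>x # js. p j}"
    proof (rule inj_onI)
      fix a b
      assume a: "a \<in> {..<\<Prod>j\<leftarrow>x # js. p j}" and b: "b \<in> {..<\<Prod>j\<leftarrow>x # js. p j}"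
        and eq: "unrank p (x # js) a = unrank p (x # js) b"
      have pos: "?N > 0" using a by (auto intro!: Nat.gr0I)
      have x1: "a div ?N = b div ?N" using fun_cong[OF eq, of x] by simp
      have "unrank p js (a mod ?N) x = undefined" "unrank p js (b mod ?N) x = undefined"
        using mem[of "a mod ?N"] mem[of "b mod ?N"] pos x by (auto simp: PiE_def extensional_def)
      then have "unrank p js (a mod ?N) = (unrank p (x # js) a)(x := undefined)"
        "unrank p js (b mod ?N) = (unrank p (x # js) b)(x := undefined)"
        by (auto simp: fun_eq_iff)
      with eq have "unrank p js (a mod ?N) = unrank p js (b mod ?N)" by metis
      then have "a mod ?N = b mod ?N"
        using pos by (intro inj_onD[OF bij_betw_imp_inj_on[OF bij]]) auto
      with x1 show "a = b" by (metis div_mult_mod_eq)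
    qed
    show "unrank p (x # js) ` {..<\<Prod>j\<leftarrow>x # js. p j} = (\<Pi>\<^sub>E j\<in>set (x # js). {..<p j})"
    proof (intro equalityI subsetI)
      fix f assume "f \<in> unrank p (x # js) ` {..<\<Prod>j\<leftarrow>x # js. p j}"
      then obtain a where a: "a < p x * ?N" and f: "f = unrank p (x # js) a" by auto
      have pos: "?N > 0" using a by (auto intro!: Nat.gr0I)
      have "a div ?N < p x" using a by (simp add: less_mult_imp_div_less)
      then show "f \<in> (\<Pi>\<^sub>E j\<in>set (x # js). {..<p j})"
        unfolding f using mem[of "a mod ?N"] pos x by (auto simp: PiE_def extensional_def Pi_def)
    next
      fix f assume f: "f \<in> (\<Pi>\<^sub>E j\<in>set (x # js). {..<p j})"
      then have "f(x := undefined) \<in> (\<Pi>\<^sub>E j\<in>set js. {..<p j})"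
        using x by (auto simp: PiE_def extensional_def Pi_def)
      then have "f(x := undefined) \<in> unrank p js ` {..<?N}"
        using bij_betw_imp_surj_on[OF bij] by blast
      then obtain b where b: "b < ?N" and fb: "f(x := undefined) = unrank p js b"
        by blast
      have fx: "f x < p x" using f by auto
      have "f x * ?N + b < Suc (f x) * ?N" using b by simp
      also have "\<dots> \<le> p x * ?N" using fx by (intro mult_right_mono) auto
      finally have lt: "f x * ?N + b < p x * ?N" .
      have "unrank p (x # js) (f x * ?N + b) = (unrank p js b)(x := f x)"
        using b by (cases "?N = 0") auto
      also have "\<dots> = f" unfolding fb[symmetric] by simp
      finally show "f \<in> unrank p (x # js) ` {..<\<Prod>j\<leftarrow>x # js. p j}"
        using lt by (intro image_eqI[of _ _ "f x * ?N + b"]) auto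
    qed
  qed
qed

end

theory Submission
  imports Defs "HOL-Analysis.L2_Norm"
begin

text \<open>
  Let \<open>Z\<close> be \<open>X\<close> with the projection \<open>U j * (U j)\<^sup>T\<close> applied to every mode \<open>j \<noteq> k\<close>.  The rows of the
  matricization of \<open>Z\<close> lie in the column space of the Kronecker product, so the complement \<open>Wperp k\<close>
  annihilates them, and Bessel's inequality bounds the left-hand side by the norm of \<open>X - Z\<close>.  Peeling
  off one projection at a time, the triangle inequality and the contractivity of projections bound the
  norm of \<open>X - Z\<close> by the sum over \<open>j \<noteq> k\<close> of the one-mode residuals, each of which has the norm of the
  contraction of \<open>X\<close> with \<open>Uperp j\<close>.
\<close>

section \<open>Matrices with orthonormal columns: isometry, Bessel's inequality, projections\<close>

lemma scalar_prod_self: "x \<bullet> x = (\<Sum>i<dim_vec x. (x $ i)\<^sup>2)" for x :: "real vec"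
  by (simp add: scalar_prod_def power2_eq_square atLeast0LessThan)

lemma scalar_prod_self_nonneg: "x \<bullet> x \<ge> 0" for x :: "real vec"
  by (simp add: scalar_prod_self sum_nonneg)

lemma scalar_prod_self_minus:
  fixes x y :: "real vec"
  assumes "x \<in> carrier_vec n" "y \<in> carrier_vec n"
  shows "(x - y) \<bullet> (x - y) = x \<bullet> x - 2 * (x \<bullet> y) + y \<bullet> y"
  using assms
  by (simp add: scalar_prod_def power2_eq_square algebra_simps sum.distrib sum_subtractf
      sum_distrib_left)

lemma orthonormal_cols_iff: "orthonormal_cols A \<longleftrightarrow> A\<^sup>T * A = 1\<^sub>m (dim_col A)"
  by (auto simp: orthonormal_cols_def mat_eq_iff)

lemma orthonormal_cols_isometry:
  assumes "orthonormal_cols A" "A \<in> carrier_mat n q" "y \<in> carrier_vec q"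
  shows "(A *\<^sub>v y) \<bullet> (A *\<^sub>v y) = y \<bullet> y"
proof -
  have "(A *\<^sub>v y) \<bullet> (A *\<^sub>v y) = (A\<^sup>T *\<^sub>v (A *\<^sub>v y)) \<bullet> y"
    using assms by (intro transpose_vec_mult_scalar[symmetric, of _ n q]) auto
  also have "A\<^sup>T *\<^sub>v (A *\<^sub>v y) = (A\<^sup>T * A) *\<^sub>v y"
    using assms by (intro assoc_mult_mat_vec[symmetric, of _ q n _ q]) auto
  also have "\<dots> = y" using assms by (simp add: orthonormal_cols_iff)
  finally show ?thesis .
qed

text \<open>With \<open>y = A\<^sup>T *\<^sub>v x\<close>, both
  \<open>x \<bullet> (A *\<^sub>v y)\<close> and the squared norm of \<open>A *\<^sub>v y\<close>
  equal \<open>y \<bullet> y\<close>. Hence the residual \<open>x - A *\<^sub>v y\<close> has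
  squared norm \<open>x \<bullet> x - y \<bullet> y\<close>, which is nonnegative.\<close>

lemma bessel:
  assumes "orthonormal_cols A" "A \<in> carrier_mat n q" "x \<in> carrier_vec n"
  shows "(A\<^sup>T *\<^sub>v x) \<bullet> (A\<^sup>T *\<^sub>v x) \<le> x \<bullet> x"
proof -
  define y where "y = A\<^sup>T *\<^sub>v x"
  have y: "y \<in> carrier_vec q" and Ay: "A *\<^sub>v y \<in> carrier_vec n" using assms by (auto simp: y_def)
  have "x \<bullet> (A *\<^sub>v y) = y \<bullet> y"
    using transpose_vec_mult_scalar[OF assms(2) y assms(3)] Ay y assms
    by (simp add: y_def comm_scalar_prod[of x n])
  then have "(x - A *\<^sub>v y) \<bullet> (x - A *\<^sub>v y) = x \<bullet> x - y \<bullet> y"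
    using orthonormal_cols_isometry[OF assms(1,2) y] scalar_prod_self_minus[OF assms(3) Ay] by simp
  then show ?thesis using scalar_prod_self_nonneg[of "x - A *\<^sub>v y"] by (simp add: y_def)
qed

lemma projection_contraction:
  assumes "orthonormal_cols A" "A \<in> carrier_mat n q" "x \<in> carrier_vec n"
  shows "((A * A\<^sup>T) *\<^sub>v x) \<bullet> ((A * A\<^sup>T) *\<^sub>v x) \<le> x \<bullet> x"
proof -
  have "(A * A\<^sup>T) *\<^sub>v x = A *\<^sub>v (A\<^sup>T *\<^sub>v x)" using assms by (intro assoc_mult_mat_vec) auto
  then show ?thesis
    using bessel[OF assms] orthonormal_cols_isometry[OF assms(1,2), of "A\<^sup>T *\<^sub>v x"] assms by simp
qed

text \<open>Orthogonality of \<open>C = [A B]\<close> also gives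
  \<open>C * C\<^sup>T = 1\<^sub>m n\<close>, which reads
  \<open>A * A\<^sup>T + B * B\<^sup>T = 1\<^sub>m n\<close> in block form. The residual is
  therefore \<open>B *\<^sub>v (B\<^sup>T *\<^sub>v x)\<close>, and \<open>B\<close> is an isometry
  because its columns are columns of \<open>C\<close>.\<close>

lemma projection_residual:
  assumes A: "A \<in> carrier_mat n q" and B: "B \<in> carrier_mat n s"
    and orth: "real_orthogonal_mat (hconcat A B)" and x: "x \<in> carrier_vec n"
  shows "(x - (A * A\<^sup>T) *\<^sub>v x) \<bullet> (x - (A * A\<^sup>T) *\<^sub>v x) = (B\<^sup>T *\<^sub>v x) \<bullet> (B\<^sup>T *\<^sub>v x)"
proof -
  define C where "C = hconcat A B"
  have "C \<in> carrier_mat n (q + s)"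
    using carrier_matD[OF A] carrier_matD[OF B] by (intro carrier_matI) (simp_all add: C_def hconcat_def)
  moreover have "square_mat C" and CtC: "C\<^sup>T * C = 1\<^sub>m (dim_row C)"
    using orth by (auto simp: real_orthogonal_mat_def C_def)
  \<comment> \<open>Squareness of \<open>C\<close>, which is part of orthogonality, forces the
    column counts to add up to \<open>n\<close>.\<close>
  ultimately have n: "n = q + s" and C: "C \<in> carrier_mat n n" by auto
  have colC: "col C i = (if i < q then col A i else col B (i - q))" if "i < n" for i
  proof -
    have "(cols A @ cols B) ! i = (if i < q then col A i else col B (i - q))"
      using that n carrier_matD[OF A] carrier_matD[OF B] by (simp add: nth_append)
    moreover have "\<dots> \<in> carrier_vec n"
      using carrier_matD(1)[OF A] carrier_matD(1)[OF B] by (intro carrier_vecI) simp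
    ultimately show ?thesis
      using that n carrier_matD[OF A] carrier_matD[OF B] unfolding C_def hconcat_def
      by (subst col_mat_of_cols) simp_all
  qed
  have C_index: "C $$ (a, i) = (if i < q then A $$ (a, i) else B $$ (a, i - q))"
    if "a < n" "i < n" for a i
  proof -
    have "C $$ (a, i) = col C i $ a" using that C by simp
    then show ?thesis using that A B n by (simp add: colC)
  qed
  have "orthonormal_cols C" using CtC C by (simp add: orthonormal_cols_iff)
  have "orthonormal_cols B"
    unfolding orthonormal_cols_def
  proof (intro allI impI)
    fix i j assume "i < dim_col B" "j < dim_col B"
    then have ij: "q + i < dim_col C" "q + j < dim_col C"
      using n carrier_matD[OF C] carrier_matD[OF B] by auto
    then have "col C (q + i) \<bullet> col C (q + j) = (if i = j then 1 else 0)"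
      using \<open>orthonormal_cols C\<close> by (simp add: orthonormal_cols_def)
    then show "col B i \<bullet> col B j = (if i = j then 1 else 0)"
      using colC[of "q + i"] colC[of "q + j"] ij carrier_matD[OF C] by simp
  qed
  \<comment> \<open>For square matrices a left inverse is also a right inverse.\<close>
  have CCt: "C * C\<^sup>T = 1\<^sub>m n"
    using CtC[unfolded carrier_matD(1)[OF C]]
    by (rule mat_mult_left_right_inverse[OF transpose_carrier_mat[THEN iffD2, OF C] C])
  have "C * C\<^sup>T = A * A\<^sup>T + B * B\<^sup>T"
  proof (rule eq_matI)
    fix a b assume "a < dim_row (A * A\<^sup>T + B * B\<^sup>T)" "b < dim_col (A * A\<^sup>T + B * B\<^sup>T)"
    then have ab: "a < n" "b < n" using A B by auto
    have "(C * C\<^sup>T) $$ (a, b) = (\<Sum>i\<in>{0..<q + s}. C $$ (a, i) * C $$ (b, i))"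
      using ab C n by (simp add: scalar_prod_def)
    also have "\<dots> = (\<Sum>i\<in>{0..<q}. A $$ (a, i) * A $$ (b, i)) +
        (\<Sum>i\<in>{q..<q + s}. B $$ (a, i - q) * B $$ (b, i - q))"
      using ab n by (subst sum.atLeastLessThan_concat[of 0 q "q + s", symmetric]) (auto simp: C_index)
    also have "(\<Sum>i\<in>{q..<q + s}. B $$ (a, i - q) * B $$ (b, i - q)) = (\<Sum>i\<in>{0..<s}. B $$ (a, i) * B $$ (b, i))"
      by (rule sum.reindex_bij_witness[of _ "\<lambda>i. i + q" "\<lambda>i. i - q"]) auto
    finally show "(C * C\<^sup>T) $$ (a, b) = (A * A\<^sup>T + B * B\<^sup>T) $$ (a, b)"
      using ab A B by (simp add: scalar_prod_def)
  qed (use A B C in auto)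
  then have sum_projections: "A * A\<^sup>T + B * B\<^sup>T = 1\<^sub>m n" using CCt by (rule trans[OF sym])
  have "x = (A * A\<^sup>T + B * B\<^sup>T) *\<^sub>v x"
    by (simp only: sum_projections one_mult_mat_vec[OF x])
  also have "\<dots> = (A * A\<^sup>T) *\<^sub>v x + (B * B\<^sup>T) *\<^sub>v x"
    using A B x by (intro add_mult_distrib_mat_vec[of _ n n]) auto
  also have "(B * B\<^sup>T) *\<^sub>v x = B *\<^sub>v (B\<^sup>T *\<^sub>v x)" using B x by (intro assoc_mult_mat_vec) auto
  finally have xeq: "x = (A * A\<^sup>T) *\<^sub>v x + B *\<^sub>v (B\<^sup>T *\<^sub>v x)" .
  have "x - (A * A\<^sup>T) *\<^sub>v x = B *\<^sub>v (B\<^sup>T *\<^sub>v x)"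
  proof (rule eq_vecI)
    fix i assume "i < dim_vec (B *\<^sub>v (B\<^sup>T *\<^sub>v x))"
    then show "(x - (A * A\<^sup>T) *\<^sub>v x) $ i = (B *\<^sub>v (B\<^sup>T *\<^sub>v x)) $ i"
      using arg_cong[OF xeq, of "\<lambda>v. v $ i"] A B
      by (simp del: index_mult_mat_vec)
  qed (use A B x in auto)
  then show ?thesis
    using orthonormal_cols_isometry[OF \<open>orthonormal_cols B\<close> B] B x by simp
qed

section \<open>Frobenius norms and contractions, fiber by fiber\<close>

lemma sum_PiE_insert:
  assumes "x \<notin> S"
  shows "(\<Sum>f\<in>PiE (insert x S) T. h f) = (\<Sum>y\<in>T x. \<Sum>g\<in>PiE S T. h (g(x := y)))"
  unfolding PiE_insert_eq sum.reindex[OF inj_combinator[OF assms]]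
  by (simp add: sum.cartesian_product case_prod_unfold)

text \<open>The summation over mode \<open>j\<close> is placed innermost so that, for squared
  entries, each inner sum is the squared norm of one mode-\<open>j\<close> fiber.\<close>

lemma sum_multi_indices:
  assumes "j \<in> {1..d}"
  shows "(\<Sum>\<mu>\<in>multi_indices d p. h \<mu>) =
    (\<Sum>g\<in>(\<Pi>\<^sub>E l\<in>{1..d} - {j}. {..<p l}). \<Sum>i<p j. h (g(j := i)))"
proof -
  have "multi_indices d p = (\<Pi>\<^sub>E l\<in>insert j ({1..d} - {j}). {..<p l})"
    using assms by (simp add: multi_indices_def insert_absorb)
  then have "(\<Sum>\<mu>\<in>multi_indices d p. h \<mu>) =
      (\<Sum>i<p j. \<Sum>g\<in>(\<Pi>\<^sub>E l\<in>{1..d} - {j}. {..<p l}). h (g(j := i)))"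
    by (simp only: sum_PiE_insert[of j "{1..d} - {j}"] Diff_iff singleton_iff simp_thms)
  also have "\<dots> = (\<Sum>g\<in>(\<Pi>\<^sub>E l\<in>{1..d} - {j}. {..<p l}). \<Sum>i<p j. h (g(j := i)))"
    by (rule sum.swap)
  finally show ?thesis .
qed

text \<open>The value \<open>g j\<close> is overwritten, so fibers can be indexed by extensional
  functions on the other modes alone.\<close>

definition fiber :: "nat \<Rightarrow> nat \<Rightarrow> tensor \<Rightarrow> (nat \<Rightarrow> nat) \<Rightarrow> real vec" where
  "fiber n j X g = vec n (\<lambda>m. X (g(j := m)))"

lemma fiber_carrier [simp]: "fiber n j X g \<in> carrier_vec n"
  by (simp add: fiber_def)

lemma tensor_frob_fibers:
  assumes "j \<in> {1..d}"
  shows "tensor_frob d p X =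
    sqrt (\<Sum>g\<in>(\<Pi>\<^sub>E l\<in>{1..d} - {j}. {..<p l}). fiber (p j) j X g \<bullet> fiber (p j) j X g)"
  by (simp add: tensor_frob_def sum_multi_indices[OF assms] scalar_prod_self fiber_def)

text \<open>This reduces every one-mode estimate to matrix-vector algebra. The transpose arises
  because \<open>mode_contract\<close> sums over the row index of \<open>A\<close>; for the
  projections \<open>A * A\<^sup>T\<close> it disappears by symmetry.\<close>

lemma fiber_mode_contract:
  assumes "A \<in> carrier_mat n q"
  shows "fiber q j (mode_contract j X A) g = A\<^sup>T *\<^sub>v fiber n j X g"
  using assms
  by (intro eq_vecI)
    (auto simp: fiber_def mode_contract_def scalar_prod_def atLeast0LessThan mult.commute)

lemma fiber_minus: "fiber n j (\<lambda>\<nu>. X \<nu> - Y \<nu>) g = fiber n j X g - fiber n j Y g"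
  by (auto simp: fiber_def)

lemma mode_contract_minus:
  "mode_contract j (\<lambda>\<nu>. X \<nu> - Y \<nu>) A = (\<lambda>\<nu>. mode_contract j X A \<nu> - mode_contract j Y A \<nu>)"
  by (simp add: mode_contract_def left_diff_distrib sum_subtractf)

lemma tensor_frob_triangle:
  "tensor_frob d p (\<lambda>\<nu>. X \<nu> - Z \<nu>) \<le> tensor_frob d p (\<lambda>\<nu>. X \<nu> - Y \<nu>) + tensor_frob d p (\<lambda>\<nu>. Y \<nu> - Z \<nu>)"
  using L2_set_triangle_ineq[of "\<lambda>\<nu>. X \<nu> - Y \<nu>" "\<lambda>\<nu>. Y \<nu> - Z \<nu>" "multi_indices d p"]
  by (simp add: tensor_frob_def L2_set_def)

lemma transpose_gram: "(A * A\<^sup>T)\<^sup>T = A * A\<^sup>T" for A :: "real mat"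
  by (simp add: transpose_mult[of A "dim_row A" "dim_col A" "A\<^sup>T" "dim_row A"])

lemma tensor_frob_mode_projection_le:
  assumes "j \<in> {1..d}" "A \<in> carrier_mat (p j) q" "orthonormal_cols A"
  shows "tensor_frob d p (mode_contract j X (A * A\<^sup>T)) \<le> tensor_frob d p X"
proof -
  have "A * A\<^sup>T \<in> carrier_mat (p j) (p j)" using assms by auto
  then show ?thesis
    unfolding tensor_frob_fibers[OF assms(1)]
    using projection_contraction[OF assms(3,2)]
    by (intro real_sqrt_le_mono sum_mono) (simp add: fiber_mode_contract transpose_gram)
qed

lemma tensor_frob_mode_residual:
  assumes "j \<in> {1..d}" "A \<in> carrier_mat (p j) q" "B \<in> carrier_mat (p j) s"
    and "real_orthogonal_mat (hconcat A B)"
  shows "tensor_frob d p (\<lambda>\<nu>. X \<nu> - mode_contract j X (A * A\<^sup>T) \<nu>) =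
    tensor_frob d (p(j := s)) (mode_contract j X B)"
proof -
  have "A * A\<^sup>T \<in> carrier_mat (p j) (p j)" using assms by auto
  \<comment> \<open>Resizing mode \<open>j\<close> does not affect the index set of the
    mode-\<open>j\<close> fibers, so both norms are sums over the same fibers.\<close>
  moreover have "(\<Pi>\<^sub>E l\<in>{1..d} - {j}. {..<(p(j := s)) l}) = (\<Pi>\<^sub>E l\<in>{1..d} - {j}. {..<p l})"
    by (intro PiE_cong) auto
  ultimately show ?thesis
    unfolding tensor_frob_fibers[OF assms(1)]
    using projection_residual[OF assms(2-4)] assms(3)
    by (simp add: fiber_minus fiber_mode_contract transpose_gram)
qed

section \<open>Contraction of several modes, and projection of several modes\<close>

definition contract_modes :: "(nat \<Rightarrow> real mat) \<Rightarrow> nat list \<Rightarrow> tensor \<Rightarrow> tensor" where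
  "contract_modes P js X = foldr (\<lambda>j Y. mode_contract j Y (P j)) js X"

lemma contract_modes_Nil [simp]: "contract_modes P [] X = X"
  and contract_modes_Cons [simp]:
    "contract_modes P (j # js) X = mode_contract j (contract_modes P js X) (P j)"
  by (simp_all add: contract_modes_def)

text \<open>Let \<open>Y\<close> be \<open>X\<close> with the modes of the tail projected, and
  \<open>P\<close> the projection of the head mode. Then X - P Y = (X - P X) + P (X - Y): the first
  summand is a one-mode residual of \<open>X\<close> itself, and \<open>P\<close> does not increase
  the norm of the second, which the induction hypothesis bounds.\<close>

lemma tensor_frob_residual_le:
  assumes "set js \<subseteq> {1..d}"
    and "\<And>j. j \<in> {1..d} \<Longrightarrow> U j \<in> carrier_mat (p j) (r j)"
    and "\<And>j. j \<in> {1..d} \<Longrightarrow> orthonormal_cols (U j)"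
    and "\<And>j. j \<in> {1..d} \<Longrightarrow> V j \<in> carrier_mat (p j) (s j)"
    and "\<And>j. j \<in> {1..d} \<Longrightarrow> real_orthogonal_mat (hconcat (U j) (V j))"
  shows "tensor_frob d p (\<lambda>\<nu>. X \<nu> - contract_modes (\<lambda>j. U j * (U j)\<^sup>T) js X \<nu>)
    \<le> (\<Sum>j\<leftarrow>js. tensor_frob d (p(j := s j)) (mode_contract j X (V j)))"
  using assms(1)
proof (induction js)
  case Nil
  then show ?case by (simp add: tensor_frob_def)
next
  case (Cons j js)
  let ?P = "\<lambda>j. U j * (U j)\<^sup>T"
  have j: "j \<in> {1..d}" using Cons.prems by simp
  have "tensor_frob d p (\<lambda>\<nu>. X \<nu> - contract_modes ?P (j # js) X \<nu>)
      \<le> tensor_frob d p (\<lambda>\<nu>. X \<nu> - mode_contract j X (?P j) \<nu>) +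
        tensor_frob d p (mode_contract j (\<lambda>\<nu>. X \<nu> - contract_modes ?P js X \<nu>) (?P j))"
    \<comment> \<open>Linearity of the contraction exposes \<open>mode_contract j X (?P j)\<close>
      as the intermediate tensor of the triangle inequality.\<close>
    unfolding mode_contract_minus contract_modes_Cons by (rule tensor_frob_triangle)
  also have "\<dots> \<le> tensor_frob d (p(j := s j)) (mode_contract j X (V j)) +
        tensor_frob d p (\<lambda>\<nu>. X \<nu> - contract_modes ?P js X \<nu>)"
    unfolding tensor_frob_mode_residual[of j d "U j" p "r j" "V j" "s j", OF j assms(2,4,5)[OF j]]
    using tensor_frob_mode_projection_le[of j d "U j" p "r j", OF j assms(2,3)[OF j]] by simp
  also have "\<dots> \<le> tensor_frob d (p(j := s j)) (mode_contract j X (V j)) +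
        (\<Sum>j\<leftarrow>js. tensor_frob d (p(j := s j)) (mode_contract j X (V j)))"
    using Cons.prems by (intro add_left_mono Cons.IH) simp
  finally show ?case by (simp only: list.map sum_list.Cons)
qed

text \<open>Unfolding the nested contractions gives one sum over all contracted modes.
  \<open>override_on\<close> takes the summation index on the modes in \<open>js\<close> and keeps
  the index of the result elsewhere. The index \<nu> stays arbitrary in the induction because the
  tail is evaluated at \<open>\<nu>(j := m)\<close>.\<close>

lemma contract_modes_kernel:
  assumes "distinct js" and "\<And>j. j \<in> set js \<Longrightarrow> dim_row (P j) = p j"
  shows "contract_modes P js X \<nu> = (\<Sum>\<mu>\<in>(\<Pi>\<^sub>E j\<in>set js. {..<p j}).
    X (override_on \<nu> \<mu> (set js)) * (\<Prod>j\<in>set js. P j $$ (\<mu> j, \<nu> j)))"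
  using assms
proof (induction js arbitrary: \<nu>)
  case Nil
  then show ?case by simp
next
  case (Cons j js)
  have j: "j \<notin> set js" using Cons.prems by simp
  \<comment> \<open>Since \<open>j\<close> does not occur in the tail, the value \<open>m\<close>
    can be moved from the result index to the summation index, ready to merge the two sums over
    \<open>insert j (set js)\<close>.\<close>
  have summand: "X (override_on (\<nu>(j := m)) \<mu> (set js)) *
        (\<Prod>l\<in>set js. P l $$ (\<mu> l, (\<nu>(j := m)) l)) * P j $$ (m, \<nu> j) =
      X (override_on \<nu> (\<mu>(j := m)) (set (j # js))) *
        (\<Prod>l\<in>set (j # js). P l $$ ((\<mu>(j := m)) l, \<nu> l))" for m \<mu>
  proof -
    have "override_on (\<nu>(j := m)) \<mu> (set js) = override_on \<nu> (\<mu>(j := m)) (set (j # js))"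
      using j by (auto simp: override_on_def)
    moreover have "(\<Prod>l\<in>set js. P l $$ (\<mu> l, (\<nu>(j := m)) l)) =
        (\<Prod>l\<in>set js. P l $$ ((\<mu>(j := m)) l, \<nu> l))"
      using j by (intro prod.cong) auto
    ultimately show ?thesis using j by simp
  qed
  have IH: "contract_modes P js X \<nu> = (\<Sum>\<mu>\<in>(\<Pi>\<^sub>E j\<in>set js. {..<p j}).
      X (override_on \<nu> \<mu> (set js)) * (\<Prod>j\<in>set js. P j $$ (\<mu> j, \<nu> j)))" for \<nu>
    using Cons.prems by (intro Cons.IH) auto
  have "contract_modes P (j # js) X \<nu> = (\<Sum>m<p j. contract_modes P js X (\<nu>(j := m)) * P j $$ (m, \<nu> j))"
    using Cons.prems by (simp add: mode_contract_def)
  also have "\<dots> = (\<Sum>m<p j. \<Sum>\<mu>\<in>(\<Pi>\<^sub>E j\<in>set js. {..<p j}).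
      X (override_on \<nu> (\<mu>(j := m)) (set (j # js))) *
        (\<Prod>l\<in>set (j # js). P l $$ ((\<mu>(j := m)) l, \<nu> l)))"
    by (simp only: IH sum_distrib_right summand)
  finally show ?case using j by (simp add: sum_PiE_insert)
qed

text \<open>
  Expanding each entry of the projections \<open>U j * (U j)\<^sup>T\<close> and interchanging sums shows that, as a
  function of the modes in \<open>js\<close>, the projected tensor is a combination of columns of the Kronecker
  product.
\<close>

lemma contract_modes_projection:
  assumes "distinct js" and "\<And>j. j \<in> set js \<Longrightarrow> U j \<in> carrier_mat (p j) (r j)"
    and "\<And>j. j \<in> set js \<Longrightarrow> \<nu> j < p j"
  shows "contract_modes (\<lambda>j. U j * (U j)\<^sup>T) js X \<nu> =
    (\<Sum>\<beta>\<in>(\<Pi>\<^sub>E j\<in>set js. {..<r j}).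
      (\<Prod>j\<in>set js. U j $$ (\<nu> j, \<beta> j)) *
      (\<Sum>\<mu>\<in>(\<Pi>\<^sub>E j\<in>set js. {..<p j}).
        X (override_on \<nu> \<mu> (set js)) * (\<Prod>j\<in>set js. U j $$ (\<mu> j, \<beta> j))))"
proof -
  let ?I = "\<Pi>\<^sub>E j\<in>set js. {..<p j}" and ?B = "\<Pi>\<^sub>E j\<in>set js. {..<r j}"
  have entry: "(\<Prod>j\<in>set js. (U j * (U j)\<^sup>T) $$ (\<mu> j, \<nu> j)) =
      (\<Sum>\<beta>\<in>?B. (\<Prod>j\<in>set js. U j $$ (\<mu> j, \<beta> j)) * (\<Prod>j\<in>set js. U j $$ (\<nu> j, \<beta> j)))"
    if "\<mu> \<in> ?I" for \<mu>
  proof -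
    have "(\<Prod>j\<in>set js. (U j * (U j)\<^sup>T) $$ (\<mu> j, \<nu> j)) =
        (\<Prod>j\<in>set js. \<Sum>b<r j. U j $$ (\<mu> j, b) * U j $$ (\<nu> j, b))"
    proof (intro prod.cong refl)
      fix j assume j: "j \<in> set js"
      then have "\<mu> j < p j" using that by auto
      then show "(U j * (U j)\<^sup>T) $$ (\<mu> j, \<nu> j) = (\<Sum>b<r j. U j $$ (\<mu> j, b) * U j $$ (\<nu> j, b))"
        using assms(2,3)[OF j] by (auto simp: scalar_prod_def atLeast0LessThan)
    qed
    \<comment> \<open>Distributivity turns the product over modes of sums over \<open>b\<close> into
      a sum over all choices \<beta> of one column per mode.\<close>
    then show ?thesis by (simp add: prod_sum_PiE prod.distrib)
  qed
  have "contract_modes (\<lambda>j. U j * (U j)\<^sup>T) js X \<nu> = (\<Sum>\<mu>\<in>?I.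
      X (override_on \<nu> \<mu> (set js)) * (\<Prod>j\<in>set js. (U j * (U j)\<^sup>T) $$ (\<mu> j, \<nu> j)))"
    using assms by (intro contract_modes_kernel) auto
  also have "\<dots> = (\<Sum>\<mu>\<in>?I. \<Sum>\<beta>\<in>?B. (\<Prod>j\<in>set js. U j $$ (\<nu> j, \<beta> j)) *
      (X (override_on \<nu> \<mu> (set js)) * (\<Prod>j\<in>set js. U j $$ (\<mu> j, \<beta> j))))"
    by (intro sum.cong refl) (simp add: entry sum_distrib_left mult_ac)
  finally show ?thesis by (subst (asm) sum.swap) (simp add: sum_distrib_left)
qed

section \<open>Matricization and the Kronecker product\<close>

lemma unrank_cong:
  assumes "\<And>j. j \<in> set js \<Longrightarrow> p j = q j"
  shows "unrank p js c = unrank q js c"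
  using assms
proof (induction js arbitrary: c)
  case (Cons j js)
  have "(\<Prod>l\<leftarrow>js. p l) = (\<Prod>l\<leftarrow>js. q l)"
    using Cons.prems by (auto cong: map_cong)
  moreover have "unrank p js c' = unrank q js c'" for c'
    using Cons.prems by (intro Cons.IH) auto
  ultimately show ?case by simp
qed simp

lemma other_modes_props: "distinct (other_modes d k)" "set (other_modes d k) = {1..d} - {k}"
  by (auto simp: other_modes_def)

text \<open>Matricization only rearranges entries: \<open>unrank\<close> maps the column numbers
  bijectively to the multi-indices on the modes other than \<open>k\<close>.\<close>

lemma tensor_frob_matricize:
  assumes k: "k \<in> {1..d}"
  shows "tensor_frob d p X = mat_frob (matricize d p k X)"
proof -
  have bij: "bij_betw (unrank p (other_modes d k)) {..<(\<Prod>j\<in>{1..d} - {k}. p j)}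
      (\<Pi>\<^sub>E j\<in>{1..d} - {k}. {..<p j})"
    using bij_betw_unrank[OF other_modes_props(1), of p] by (simp add: other_modes_props prod_list_other_modes)
  have "(\<Sum>\<mu>\<in>multi_indices d p. (X \<mu>)\<^sup>2) =
      (\<Sum>c<(\<Prod>j\<in>{1..d} - {k}. p j). \<Sum>i<p k. (X ((unrank p (other_modes d k) c)(k := i)))\<^sup>2)"
    unfolding sum_multi_indices[OF k] by (rule sum.reindex_bij_betw[OF bij, symmetric])
  also have "\<dots> = (\<Sum>i<p k. \<Sum>c<(\<Prod>j\<in>{1..d} - {k}. p j).
      (matricize d p k X $$ (i, c))\<^sup>2)"
    by (subst sum.swap) (simp add: matricize_def)
  finally show ?thesis by (simp add: tensor_frob_def mat_frob_def matricize_def)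
qed

text \<open>The expansion in \<open>contract_modes_projection\<close> has coefficients that depend
  on the result index only through mode \<open>k\<close>. Along row \<open>i\<close> they are thus
  the same for every column, and listed in the order of \<open>unrank\<close> they form the vector
  \<open>y\<close>.\<close>

lemma row_matricize_projection:
  assumes k: "k \<in> {1..d}" and U: "\<And>j. j \<in> {1..d} \<Longrightarrow> U j \<in> carrier_mat (p j) (r j)"
    and i: "i < p k"
  defines "js \<equiv> other_modes d k"
  shows "\<exists>y \<in> carrier_vec (dim_col (kron_list (map U js))).
    row (matricize d p k (contract_modes (\<lambda>j. U j * (U j)\<^sup>T) js X)) i = kron_list (map U js) *\<^sub>v y"
proof -
  let ?N = "\<Prod>j\<leftarrow>js. p j" and ?R = "\<Prod>j\<leftarrow>js. r j"
  have js: "distinct js" "set js = {1..d} - {k}" by (simp_all add: js_def other_modes_props)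
  have dim_U: "dim_row (U j) = p j" "dim_col (U j) = r j" if "j \<in> set js" for j
    using U[of j] that js(2) by auto
  then have dims: "(\<Prod>j\<leftarrow>js. dim_row (U j)) = ?N" "(\<Prod>j\<leftarrow>js. dim_col (U j)) = ?R"
    by (auto cong: map_cong)
  \<comment> \<open>\<open>kron_list_index\<close> unranks with the dimensions of the factors, which
    are known to agree with \<open>p\<close> and \<open>r\<close> on the modes in \<open>js\<close>;
    \<open>unrank\<close> inspects no others.\<close>
  have unr: "unrank (\<lambda>l. dim_row (U l)) js c = unrank p js c"
    "unrank (\<lambda>l. dim_col (U l)) js c = unrank r js c" for c
    using dim_U by (simp_all cong: unrank_cong)
  have number_of_cols: "(\<Prod>j\<in>{1..d} - {k}. p j) = ?N" by (simp add: js_def prod_list_other_modes)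
  define Y where "Y \<nu> \<beta> = (\<Sum>\<mu>\<in>(\<Pi>\<^sub>E j\<in>set js. {..<p j}).
    X (override_on \<nu> \<mu> (set js)) * (\<Prod>j\<in>set js. U j $$ (\<mu> j, \<beta> j)))" for \<nu> \<beta>
  \<comment> \<open>\<open>override_on\<close> replaces the values on \<open>js\<close>, so only
    mode \<open>k\<close> has to be set. The default \<open>undefined\<close> elsewhere matches the
    extensional indices produced by \<open>unrank\<close>, so the arguments of \<open>X\<close>
    agree as functions; this gives \<open>Y_eq\<close>.\<close>
  define y where "y = vec ?R (\<lambda>b. Y ((\<lambda>_. undefined)(k := i)) (unrank r js b))"
  have "row (matricize d p k (contract_modes (\<lambda>j. U j * (U j)\<^sup>T) js X)) i = kron_list (map U js) *\<^sub>v y"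
  proof (rule eq_vecI)
    show "dim_vec (row (matricize d p k (contract_modes (\<lambda>j. U j * (U j)\<^sup>T) js X)) i) =
        dim_vec (kron_list (map U js) *\<^sub>v y)"
      by (simp add: dims matricize_def number_of_cols del: One_nat_def)
    fix c assume "c < dim_vec (kron_list (map U js) *\<^sub>v y)"
    then have c: "c < ?N" by (simp add: dims)
    define \<nu> where "\<nu> = (unrank p js c)(k := i)"
    have unrank_c: "unrank p js c \<in> (\<Pi>\<^sub>E j\<in>set js. {..<p j})"
      using bij_betwE[OF bij_betw_unrank[OF js(1)]] c by blast
    have \<nu>: "\<nu> j < p j" if "j \<in> set js" for j
    proof -
      have "j \<noteq> k" using that js(2) by auto
      then show ?thesis using PiE_mem[OF unrank_c that] by (simp add: \<nu>_def)
    qed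
    have Y_eq: "Y \<nu> \<beta> = Y ((\<lambda>_. undefined)(k := i)) \<beta>" for \<beta>
    proof -
      have "override_on \<nu> \<mu> (set js) = override_on ((\<lambda>_. undefined)(k := i)) \<mu> (set js)" for \<mu>
        using unrank_c by (auto simp: \<nu>_def override_on_def PiE_def extensional_def)
      then show ?thesis by (simp add: Y_def)
    qed
    have "row (matricize d p k (contract_modes (\<lambda>j. U j * (U j)\<^sup>T) js X)) i $ c =
        contract_modes (\<lambda>j. U j * (U j)\<^sup>T) js X \<nu>"
      using c i by (simp add: matricize_def \<nu>_def js_def prod_list_other_modes)
    also have "\<dots> = (\<Sum>\<beta>\<in>(\<Pi>\<^sub>E j\<in>set js. {..<r j}). (\<Prod>j\<in>set js. U j $$ (\<nu> j, \<beta> j)) * Y \<nu> \<beta>)"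
      unfolding Y_def using U js \<nu> by (intro contract_modes_projection) auto
    also have "\<dots> = (\<Sum>b<?R. (\<Prod>j\<in>set js. U j $$ (\<nu> j, unrank r js b j)) * Y \<nu> (unrank r js b))"
      \<comment> \<open>Numbering the column choices \<beta> by \<open>unrank r js\<close> matches
        them with the columns of the Kronecker product.\<close>
      by (rule sum.reindex_bij_betw[OF bij_betw_unrank[OF js(1)], symmetric])
    also have "\<dots> = (\<Sum>b<?R. kron_list (map U js) $$ (c, b) * y $ b)"
    proof (intro sum.cong refl arg_cong2[where f = "(*)"])
      fix b assume b: "b \<in> {..<?R}"
      show "Y \<nu> (unrank r js b) = y $ b" using b by (simp add: Y_eq y_def)
      have "kron_list (map U js) $$ (c, b) = (\<Prod>j\<in>set js. U j $$ (unrank p js c j, unrank r js b j))"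
        using kron_list_index[OF js(1), of c U b] b c by (simp add: dims unr)
      also have "\<dots> = (\<Prod>j\<in>set js. U j $$ (\<nu> j, unrank r js b j))"
        using js(2) by (intro prod.cong) (auto simp: \<nu>_def)
      finally show "(\<Prod>j\<in>set js. U j $$ (\<nu> j, unrank r js b j)) = kron_list (map U js) $$ (c, b)" ..
    qed
    also have "\<dots> = (kron_list (map U js) *\<^sub>v y) $ c"
      using c by (simp add: dims scalar_prod_def atLeast0LessThan y_def)
    finally show "row (matricize d p k (contract_modes (\<lambda>j. U j * (U j)\<^sup>T) js X)) i $ c =
        (kron_list (map U js) *\<^sub>v y) $ c" .
  qed
  moreover have "y \<in> carrier_vec (dim_col (kron_list (map U js)))" by (simp add: y_def dims)
  ultimately show ?thesis by blast
qed

section \<open>The orthogonal complement of the Kronecker product, and the final estimate\<close>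

lemma transpose_complement_mult:
  assumes "orthonormal_basis_of_complement W V"
  shows "V\<^sup>T * W = 0\<^sub>m (dim_col V) (dim_col W)"
proof (rule eq_matI)
  fix i j assume "i < dim_row (0\<^sub>m (dim_col V) (dim_col W))" "j < dim_col (0\<^sub>m (dim_col V) (dim_col W))"
  then have ij: "i < dim_col V" "j < dim_col W" by auto
  interpret vec_space "TYPE(real)" "dim_row W" .
  have dim: "dim_row V = dim_row W" and space: "col_space V = orthogonal_complement (col_space W)"
    using assms by (auto simp: orthonormal_basis_of_complement_def)
  have "set (cols V) \<subseteq> col_space V" "set (cols W) \<subseteq> col_space W"
    unfolding col_space_def using cols_dim[of V] cols_dim[of W] dim by (simp_all add: in_own_span)
  then have "col V i \<in> col_space V" "col W j \<in> col_space W"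
    using ij by (auto simp: cols_def)
  then have "col V i \<bullet> col W j = 0" unfolding space by (simp add: orthogonal_complement_def)
  then show "(V\<^sup>T * W) $$ (i, j) = 0\<^sub>m (dim_col V) (dim_col W) $$ (i, j)" using ij by simp
qed auto

lemma mat_frob_rows: "mat_frob A = sqrt (\<Sum>i<dim_row A. row A i \<bullet> row A i)"
  by (simp add: mat_frob_def scalar_prod_self)

text \<open>This turns right multiplication of a matricization into a matrix acting on its rows, the
  form in which \<open>bessel\<close> applies.\<close>

lemma row_mult_transpose:
  fixes A B :: "real mat"
  assumes "i < dim_row A" "dim_col A = dim_row B"
  shows "row (A * B) i = B\<^sup>T *\<^sub>v row A i"
  using assms by (intro eq_vecI) (auto intro!: comm_scalar_prod[of _ "dim_row B"] carrier_vecI)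

theorem lemma19:
  fixes d :: nat and p r :: "nat \<Rightarrow> nat" and X :: tensor
    and U Uperp Wperp :: "nat \<Rightarrow> real mat"
  assumes "\<And>j. j \<in> {1..d} \<Longrightarrow> U j \<in> carrier_mat (p j) (r j)"
    and "\<And>j. j \<in> {1..d} \<Longrightarrow> orthonormal_cols (U j)"
    and "\<And>j. j \<in> {1..d} \<Longrightarrow> Uperp j \<in> carrier_mat (p j) (p j - r j)"
    and "\<And>j. j \<in> {1..d} \<Longrightarrow> real_orthogonal_mat (hconcat (U j) (Uperp j))"
    and "\<And>k. k \<in> {1..d} \<Longrightarrow>
      orthonormal_basis_of_complement (kron_list (map U (other_modes d k))) (Wperp k)"
  shows "\<forall>k\<in>{1..d}.
    mat_frob (matricize d p k X * Wperp k)
      \<le> (\<Sum>j\<in>{1..d} - {k}.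
           tensor_frob d (p(j := p j - r j)) (mode_contract j X (Uperp j)))"
proof
  fix k assume k: "k \<in> {1..d}"
  define js where "js = other_modes d k"
  define W where "W = kron_list (map U js)"
  define V where "V = Wperp k"
  define Z where "Z = contract_modes (\<lambda>j. U j * (U j)\<^sup>T) js X"
  let ?M = "matricize d p k" and ?N = "\<Prod>j\<in>{1..d} - {k}. p j"
  have js: "distinct js" "set js = {1..d} - {k}" by (simp_all add: js_def other_modes_props)
  have compl: "orthonormal_basis_of_complement W V" using assms(5)[OF k] by (simp add: W_def V_def js_def)
  have "dim_row (U j) = p j" if "j \<in> set js" for j
    using assms(1)[of j] that js(2) by auto
  then have "(\<Prod>j\<leftarrow>js. dim_row (U j)) = (\<Prod>j\<leftarrow>js. p j)" by (auto cong: map_cong)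
  then have W: "W \<in> carrier_mat ?N (dim_col W)"
    unfolding W_def carrier_mat_def js_def by (simp add: prod_list_other_modes)
  have V: "V \<in> carrier_mat ?N (dim_col V)" and orth: "orthonormal_cols V"
    using compl W by (auto simp: orthonormal_basis_of_complement_def)
  have dim_M: "?M Y \<in> carrier_mat (p k) ?N" for Y by (simp add: matricize_def)
  \<comment> \<open>Row \<open>i\<close> of \<open>?M Z\<close> lies in the column space of
    \<open>W\<close> and is annihilated by \<open>V\<^sup>T\<close>. Subtracting \<open>Z\<close>
    thus leaves row \<open>i\<close> of \<open>?M X * V\<close> unchanged, and Bessel's inequality
    can be applied to the row of the difference instead of the row of \<open>?M X\<close>.\<close>
  have row_le: "row (?M X * V) i \<bullet> row (?M X * V) i
      \<le> row (?M (\<lambda>\<nu>. X \<nu> - Z \<nu>)) i \<bullet> row (?M (\<lambda>\<nu>. X \<nu> - Z \<nu>)) i" if i: "i < p k" for i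
  proof -
    have "\<exists>y\<in>carrier_vec (dim_col W). row (?M Z) i = W *\<^sub>v y"
      unfolding Z_def W_def js_def by (rule row_matricize_projection[of k d U p r i X, OF k assms(1) i])
    then obtain y where y: "y \<in> carrier_vec (dim_col W)" and rowZ: "row (?M Z) i = W *\<^sub>v y" ..
    have rows: "row (?M Y) i \<in> carrier_vec ?N" for Y
      by (rule carrier_vecI) (simp add: matricize_def)
    have "V\<^sup>T *\<^sub>v row (?M Z) i = (V\<^sup>T * W) *\<^sub>v y"
      unfolding rowZ
      by (rule assoc_mult_mat_vec[symmetric, OF transpose_carrier_mat[THEN iffD2, OF V] W y])
    also have "\<dots> = 0\<^sub>v (dim_col V)"
      unfolding transpose_complement_mult[OF compl] using y by (intro eq_vecI) auto
    finally have VZ: "V\<^sup>T *\<^sub>v row (?M Z) i = 0\<^sub>v (dim_col V)" .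
    have "row (?M (\<lambda>\<nu>. X \<nu> - Z \<nu>)) i = row (?M X) i - row (?M Z) i"
      using i by (intro eq_vecI) (auto simp: matricize_def)
    then have "V\<^sup>T *\<^sub>v row (?M (\<lambda>\<nu>. X \<nu> - Z \<nu>)) i = V\<^sup>T *\<^sub>v row (?M X) i - V\<^sup>T *\<^sub>v row (?M Z) i"
      by (simp only: mult_minus_distrib_mat_vec[OF transpose_carrier_mat[THEN iffD2, OF V] rows rows])
    also have "\<dots> = V\<^sup>T *\<^sub>v row (?M X) i" unfolding VZ by (intro eq_vecI) auto
    also have "\<dots> = row (?M X * V) i"
      using i carrier_matD[OF dim_M[of X]] carrier_matD(1)[OF V]
      by (intro row_mult_transpose[symmetric]) simp_all
    finally show ?thesis using bessel[OF orth V rows[of "\<lambda>\<nu>. X \<nu> - Z \<nu>"]] by (simp only:)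
  qed
  have "mat_frob (?M X * V) \<le> mat_frob (?M (\<lambda>\<nu>. X \<nu> - Z \<nu>))"
    unfolding mat_frob_rows using row_le
    by (auto intro!: real_sqrt_le_mono sum_mono simp: carrier_matD(1)[OF dim_M])
  also have "\<dots> = tensor_frob d p (\<lambda>\<nu>. X \<nu> - Z \<nu>)" by (rule tensor_frob_matricize[OF k, symmetric])
  also have "\<dots> \<le> (\<Sum>j\<leftarrow>js. tensor_frob d (p(j := p j - r j)) (mode_contract j X (Uperp j)))"
    unfolding Z_def
    by (rule tensor_frob_residual_le[of js d U p r Uperp "\<lambda>j. p j - r j", OF _ assms(1-4)])
      (simp add: js(2))
  also have "\<dots> = (\<Sum>j\<in>{1..d} - {k}. tensor_frob d (p(j := p j - r j)) (mode_contract j X (Uperp j)))"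
    using js by (simp add: sum_list_distinct_conv_sum_set)
  finally show "mat_frob (?M X * Wperp k) \<le>
      (\<Sum>j\<in>{1..d} - {k}. tensor_frob d (p(j := p j - r j)) (mode_contract j X (Uperp j)))"
    by (simp add: V_def)
qed

end
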